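(* Let $A=\mathrm{diag}(\lambda_1,\dots,\lambda_n)\in\mathbb{R}^{n\times n}$ with $1=\lambda_1\le\lambda_2\le\dots\le\lambda_n$, let $b\in\mathbb{R}^n$, and let $l\ge 1$ and $m\ge 1$ be integers. Consider the gradient method $x_{k+1}=x_k-\alpha_k g_k$, $g_k=Ax_k-b$, $k=0,1,2,\dots$, applied to the linear system $Ax=b$ from a starting point $x_0\in\mathbb{R}^n$, with steplength $\alpha_k=\alpha_k^{\mathrm{CY}}$, where $$\alpha_k^{\mathrm{CY}}=\begin{cases}\alpha_k^{\mathrm{Y}}, & \text{if } k\bmod (l+m+2)=1,\\ \alpha_k^{\mathrm{SD}}, & \text{if } k\bmod (l+m+2)<l+2 \text{ and } k\bmod(l+m+2)\neq 1,\\ \alpha_{k-1}, & \text{otherwise.}\end{cases}$$ Then the steplength $\alpha_k^{\mathrm{CY}}$ has Property A.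
   Context: Steplengths. For the iterates $x_k$ and gradients $g_k=Ax_k-b$ generated by the method, the steepest descent steplength is $$\alpha_k^{\mathrm{SD}}=\frac{g_k^\intercal g_k}{g_k^\intercal A g_k},$$ and, for $k\ge 1$ and with $s_{k-1}=x_k-x_{k-1}$, the Yuan steplength is $$\alpha_k^{\mathrm{Y}}=\frac{2}{\sqrt{\left(\frac{1}{\alpha_{k-1}^{\mathrm{SD}}}-\frac{1}{\alpha_k^{\mathrm{SD}}}\right)^2+\frac{4\,g_k^\intercal g_k}{s_{k-1}^\intercal s_{k-1}}}+\frac{1}{\alpha_{k-1}^{\mathrm{SD}}}+\frac{1}{\alpha_k^{\mathrm{SD}}}}.$$ Here $\alpha_{k-1}$ denotes the steplength actually used at iteration $k-1$. The iteration stops as soon as $g_k=0$; only indices $k$ with $g_0,\dots,g_k\neq 0$ are considered, so that all steplengths are well defined. Notation. Let $g_{i,k}$ denote the $i$th component of $g_k$, and for $\mu\in\{1,\dots,n\}$ let $G(k,\mu)=\sum_{i=1}^{\mu} g_{i,k}^2$. Property A. Let $A=\mathrm{diag}(\lambda_1,\dots,\lambda_n)$ with $1=\lambda_1\le\dots\le\lambda_n$. The steplength $\alpha_k$ of a gradient method $x_{k+1}=x_k-\alpha_k g_k$ has Property A if there exist a positive integer $\xi$ and constants $M_1,M_2>0$, all independent of $k$, such that: (i) $\lambda_1\le\alpha_k^{-1}\le M_1$ for every $k\ge 0$; (ii) for every $k\ge 1$, every $\mu\in\{1,\dots,n-1\}$ and every $\epsilon>0$: if $G(k-j,\mu)\le\epsilon$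 and $g_{\mu+1,k-j}^2\ge M_2\epsilon$ hold for all $j\in\{0,\dots,\min\{k,\xi\}-1\}$, then $\alpha_k^{-1}\ge\frac{2}{3}\lambda_{\mu+1}$. *)

theory Defs
  imports Complex_Main "Jordan_Normal_Form.Matrix"
begin

text \<open>
  Eigenvalues are indexed from 1 (\<open>lam 1, ..., lam n\<close>), while the entries of a vector
  \<open>v\<close> are \<open>v $ 0, ..., v $ (n - 1)\<close>.  The \<open>i\<close>th component in the usual 1-based numbering
  is therefore \<open>v $ (i - 1)\<close>.
\<close>

definition diag_matrix :: "nat \<Rightarrow> (nat \<Rightarrow> real) \<Rightarrow> real mat" where
  "diag_matrix n lam = mat_diag n (\<lambda>i. lam (Suc i))"

definition grad :: "real mat \<Rightarrow> real vec \<Rightarrow> (nat \<Rightarrow> real vec) \<Rightarrow> nat \<Rightarrow> real vec" where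
  "grad A b x k = A *\<^sub>v x k - b"

text \<open>
  The iteration stops at the first vanishing gradient.  Only indices satisfying \<open>running\<close> are
  constrained or considered below; the values of \<open>x\<close> and \<open>\<alpha>\<close> at later indices are junk.
\<close>

definition running :: "real mat \<Rightarrow> real vec \<Rightarrow> (nat \<Rightarrow> real vec) \<Rightarrow> nat \<Rightarrow> bool" where
  "running A b x k \<longleftrightarrow> (\<forall>j\<le>k. grad A b x j \<noteq> 0\<^sub>v (dim_vec b))"

definition gradient_method ::
  "real mat \<Rightarrow> real vec \<Rightarrow> (nat \<Rightarrow> real vec) \<Rightarrow> (nat \<Rightarrow> real) \<Rightarrow> bool" where
  "gradient_method A b x \<alpha> \<longleftrightarrow>
     (\<forall>k. running A b x k \<longrightarrow> x (Suc k) = x k - \<alpha> k \<cdot>\<^sub>v grad A b x k)"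

definition sd_step :: "real mat \<Rightarrow> real vec \<Rightarrow> (nat \<Rightarrow> real vec) \<Rightarrow> nat \<Rightarrow> real" where
  "sd_step A b x k =
     (let g = grad A b x k in (g \<bullet> g) / (g \<bullet> (A *\<^sub>v g)))"

text \<open>Meaningful for \<open>k \<ge> 1\<close> only.\<close>

definition yuan_step :: "real mat \<Rightarrow> real vec \<Rightarrow> (nat \<Rightarrow> real vec) \<Rightarrow> nat \<Rightarrow> real" where
  "yuan_step A b x k =
     (let g = grad A b x k;
          s = x k - x (k - 1);
          p = 1 / sd_step A b x (k - 1);
          q = 1 / sd_step A b x k
      in 2 / (sqrt ((p - q)\<^sup>2 + 4 * (g \<bullet> g) / (s \<bullet> s)) + p + q))"

text \<open>
  The last branch is reached only if \<open>k mod (l + m + 2) \<ge> l + 2\<close>, hence \<open>k \<ge> 1\<close>, and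
  \<open>yuan_step\<close> only if \<open>k mod (l + m + 2) = 1\<close>, so the truncated \<open>k - 1\<close> is harmless.
\<close>

definition cy_step ::
  "nat \<Rightarrow> nat \<Rightarrow> real mat \<Rightarrow> real vec \<Rightarrow> (nat \<Rightarrow> real vec) \<Rightarrow> (nat \<Rightarrow> real) \<Rightarrow> nat \<Rightarrow> real" where
  "cy_step l m A b x \<alpha> k =
     (if k mod (l + m + 2) = 1 then yuan_step A b x k
      else if k mod (l + m + 2) < l + 2 then sd_step A b x k
      else \<alpha> (k - 1))"

definition G :: "real mat \<Rightarrow> real vec \<Rightarrow> (nat \<Rightarrow> real vec) \<Rightarrow> nat \<Rightarrow> nat \<Rightarrow> real" where
  "G A b x k \<mu> = (\<Sum>i = 1..\<mu>. (grad A b x k $ (i - 1))\<^sup>2)"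

text \<open>
  The entry \<open>$ \<mu>\<close> below is the component number \<open>\<mu> + 1\<close>.
\<close>

definition property_A ::
  "nat \<Rightarrow> (nat \<Rightarrow> real) \<Rightarrow> real vec \<Rightarrow> (nat \<Rightarrow> real vec) \<Rightarrow> (nat \<Rightarrow> real) \<Rightarrow> bool" where
  "property_A n lam b x \<alpha> \<longleftrightarrow>
     (let A = diag_matrix n lam in
      \<exists>(\<xi>::nat) (M1::real) (M2::real). \<xi> > 0 \<and> M1 > 0 \<and> M2 > 0 \<and>
        (\<forall>k. running A b x k \<longrightarrow> lam 1 \<le> inverse (\<alpha> k) \<and> inverse (\<alpha> k) \<le> M1) \<and>
        (\<forall>k \<mu>. \<forall>\<epsilon>::real. running A b x k \<longrightarrow> k \<ge> 1 \<longrightarrow> \<mu> \<in> {1..n - 1} \<longrightarrow> \<epsilon> > 0 \<longrightarrow>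
           (\<forall>j \<in> {0..min k \<xi> - 1}.
              G A b x (k - j) \<mu> \<le> \<epsilon> \<and> (grad A b x (k - j) $ \<mu>)\<^sup>2 \<ge> M2 * \<epsilon>) \<longrightarrow>
           inverse (\<alpha> k) \<ge> 2 / 3 * lam (\<mu> + 1)))"

end

theory Submission
  imports Defs
begin

text \<open>
  The reciprocal of the steepest descent steplength is the Rayleigh quotient
  \<open>q = (g\<^sup>T A g) / (g\<^sup>T g)\<close>, a weighted mean of the eigenvalues with weights
  \<open>g\<^sub>i\<^sup>2\<close>.  So it lies between \<open>1\<close> and \<open>L = lam n\<close>; and as soon as the components from
  \<open>\<mu> + 1\<close> on carry at least two thirds of the weight, it is at least
  \<open>2/3 * lam (\<mu> + 1)\<close>.  The hypotheses of Property A give this share of the weight for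
  \<open>M\<^sub>2 = 2\<close>.

  The reciprocal of the Yuan steplength is the larger eigenvalue of the symmetric matrix with
  diagonal \<open>p, q\<close> (two consecutive Rayleigh quotients) and off-diagonal entry
  \<open>c = norm g / norm s\<close>.  It therefore lies between \<open>max p q\<close> and \<open>max p q + c\<close>.  The lower
  estimate makes it inherit every lower bound of the Rayleigh quotient \<open>q\<close>.  For the upper one,
  a Yuan step always follows a steepest descent step, which multiplies each gradient component
  by a factor of modulus at most \<open>L\<close>, whereas \<open>norm s\<close> is at least \<open>1 / L\<close> times the norm of the
  old gradient; so \<open>c \<le> L\<^sup>2\<close>.  This gives \<open>M\<^sub>1 = L + L\<^sup>2\<close>.

  The remaining steps repeat the steplength of the index with residue \<open>l + 1\<close> in
  the same cycle, at most \<open>m\<close> iterations earlier.  With \<open>\<xi> = m + 1\<close>, the hypotheses of Property A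
  cover that index too.
\<close>

section \<open>Rayleigh quotients of a diagonal matrix\<close>

lemma diag_matrix_carrier [simp]: "diag_matrix n lam \<in> carrier_mat n n"
  by (simp add: diag_matrix_def)

lemma diag_matrix_mult_vec:
  assumes "v \<in> carrier_vec n"
  shows "diag_matrix n lam *\<^sub>v v = vec n (\<lambda>i. lam (Suc i) * v $ i)"
proof (rule eq_vecI)
  fix i assume "i < dim_vec (vec n (\<lambda>i. lam (Suc i) * v $ i))"
  then have i: "i < n" by simp
  have "(diag_matrix n lam *\<^sub>v v) $ i = (\<Sum>j<n. (if i = j then lam (Suc j) else 0) * v $ j)"
    using assms i
    by (simp add: diag_matrix_def mat_diag_def scalar_prod_def lessThan_atLeast0)
  also have "\<dots> = (\<Sum>j<n. if i = j then lam (Suc j) * v $ j else 0)"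
    by (rule sum.cong) auto
  also have "\<dots> = lam (Suc i) * v $ i"
    using i by simp
  finally show "(diag_matrix n lam *\<^sub>v v) $ i = vec n (\<lambda>i. lam (Suc i) * v $ i) $ i"
    using i by simp
qed (simp add: diag_matrix_def mat_diag_def)

lemma scalar_prod_self:
  fixes v :: "real vec"
  assumes "v \<in> carrier_vec n"
  shows "v \<bullet> v = (\<Sum>i<n. (v $ i)\<^sup>2)"
  using assms by (simp add: scalar_prod_def power2_eq_square lessThan_atLeast0)

lemma scalar_prod_diag_matrix:
  assumes "v \<in> carrier_vec n"
  shows "v \<bullet> (diag_matrix n lam *\<^sub>v v) = (\<Sum>i<n. lam (Suc i) * (v $ i)\<^sup>2)"
  using assms
  by (simp add: diag_matrix_mult_vec scalar_prod_def power2_eq_square lessThan_atLeast0 ac_simps)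

lemma scalar_prod_self_pos:
  fixes v :: "real vec"
  assumes v: "v \<in> carrier_vec n" and "v \<noteq> 0\<^sub>v n"
  shows "0 < v \<bullet> v"
proof -
  obtain i where i: "i < n" "v $ i \<noteq> 0"
    using assms by (metis carrier_vecD dim_vec eq_vecI index_zero_vec)
  have "0 < (v $ i)\<^sup>2" using i by simp
  also have "\<dots> \<le> (\<Sum>i<n. (v $ i)\<^sup>2)"
    using i by (intro member_le_sum) auto
  finally show ?thesis using scalar_prod_self[OF v] by simp
qed

definition rayleigh :: "nat \<Rightarrow> (nat \<Rightarrow> real) \<Rightarrow> real vec \<Rightarrow> real" where
  "rayleigh n lam v = (v \<bullet> (diag_matrix n lam *\<^sub>v v)) / (v \<bullet> v)"

lemma rayleigh_bounds:
  assumes v: "v \<in> carrier_vec n" "v \<noteq> 0\<^sub>v n"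
    and lo: "\<And>i. i < n \<Longrightarrow> a \<le> lam (Suc i)" and hi: "\<And>i. i < n \<Longrightarrow> lam (Suc i) \<le> c"
  shows "a \<le> rayleigh n lam v" "rayleigh n lam v \<le> c"
proof -
  note pos = scalar_prod_self_pos[OF v]
  have "a * (v \<bullet> v) \<le> v \<bullet> (diag_matrix n lam *\<^sub>v v)"
    unfolding scalar_prod_self[OF v(1)] scalar_prod_diag_matrix[OF v(1)] sum_distrib_left
    using lo by (intro sum_mono mult_right_mono) auto
  then show "a \<le> rayleigh n lam v"
    using pos by (simp add: rayleigh_def pos_le_divide_eq)
  have "v \<bullet> (diag_matrix n lam *\<^sub>v v) \<le> c * (v \<bullet> v)"
    unfolding scalar_prod_self[OF v(1)] scalar_prod_diag_matrix[OF v(1)] sum_distrib_left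
    using hi by (intro sum_mono mult_right_mono) auto
  then show "rayleigh n lam v \<le> c"
    using pos by (simp add: rayleigh_def pos_divide_le_eq)
qed

text \<open>
  The weight below \<open>\<mu>\<close> is at most half the weight of the single component \<open>\<mu>\<close>, so the
  components from \<open>\<mu>\<close> on carry at least two thirds of the total weight; each of them enters the
  weighted mean with an eigenvalue at least \<open>lam (Suc \<mu>)\<close>, the others with a nonnegative one.
\<close>
lemma rayleigh_ge_of_dominant_component:
  assumes v: "v \<in> carrier_vec n" "v \<noteq> 0\<^sub>v n"
    and \<mu>: "\<mu> < n" and nonneg: "\<And>i. i < n \<Longrightarrow> 0 \<le> lam (Suc i)"
    and tail: "\<And>i. \<mu> \<le> i \<Longrightarrow> i < n \<Longrightarrow> lam (Suc \<mu>) \<le> lam (Suc i)"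
    and dom: "2 * (\<Sum>i<\<mu>. (v $ i)\<^sup>2) \<le> (v $ \<mu>)\<^sup>2"
  shows "2 / 3 * lam (Suc \<mu>) \<le> rayleigh n lam v"
proof -
  define H where "H = (\<Sum>i<\<mu>. (v $ i)\<^sup>2)"
  define T where "T = (\<Sum>i\<in>{\<mu>..<n}. (v $ i)\<^sup>2)"
  have split: "sum f {..<n} = sum f {..<\<mu>} + sum f {\<mu>..<n}" for f :: "nat \<Rightarrow> real"
    using \<mu> sum.atLeastLessThan_concat[of 0 \<mu> n f] by (simp add: lessThan_atLeast0)
  have "(v $ \<mu>)\<^sup>2 \<le> T"
    unfolding T_def using \<mu> by (intro member_le_sum) auto
  with dom have HT: "2 * H \<le> T" by (simp add: H_def)
  have tot: "v \<bullet> v = H + T"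
    by (simp add: scalar_prod_self[OF v(1)] split H_def T_def)
  have "2 / 3 * lam (Suc \<mu>) * (v \<bullet> v) \<le> lam (Suc \<mu>) * T"
    using mult_left_mono[OF HT nonneg[OF \<mu>]] by (simp add: tot algebra_simps)
  also have "\<dots> \<le> (\<Sum>i\<in>{\<mu>..<n}. lam (Suc i) * (v $ i)\<^sup>2)"
    unfolding T_def sum_distrib_left
    using tail by (intro sum_mono mult_right_mono) auto
  also have "\<dots> \<le> v \<bullet> (diag_matrix n lam *\<^sub>v v)"
    unfolding scalar_prod_diag_matrix[OF v(1)] split[of "\<lambda>i. lam (Suc i) * (v $ i)\<^sup>2"]
    using \<mu> nonneg by (auto intro!: sum_nonneg mult_nonneg_nonneg)
  finally show ?thesis
    using scalar_prod_self_pos[OF v] by (simp add: rayleigh_def pos_le_divide_eq)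
qed

section \<open>The Yuan formula\<close>

text \<open>
  The expression is the larger eigenvalue of the symmetric matrix with diagonal \<open>p, q\<close> and
  squared off-diagonal entry \<open>c\<close>.
\<close>
lemma yuan_formula_bounds:
  fixes p q c d :: real
  assumes "0 \<le> c" "c \<le> d\<^sup>2" "0 \<le> d"
  shows "max p q \<le> (sqrt ((p - q)\<^sup>2 + 4 * c) + p + q) / 2"
    and "(sqrt ((p - q)\<^sup>2 + 4 * c) + p + q) / 2 \<le> max p q + d"
proof -
  have "\<bar>p - q\<bar> \<le> sqrt ((p - q)\<^sup>2 + 4 * c)"
    using assms by (intro real_le_rsqrt) simp
  then show "max p q \<le> (sqrt ((p - q)\<^sup>2 + 4 * c) + p + q) / 2"
    by (cases "p \<le> q") (auto simp: abs_le_iff)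
  have "(\<bar>p - q\<bar> + 2 * d)\<^sup>2 = (p - q)\<^sup>2 + 4 * d\<^sup>2 + 4 * (\<bar>p - q\<bar> * d)"
    unfolding power2_sum power_mult_distrib power2_abs by simp
  moreover have "0 \<le> \<bar>p - q\<bar> * d" using assms by simp
  ultimately have "(p - q)\<^sup>2 + 4 * c \<le> (\<bar>p - q\<bar> + 2 * d)\<^sup>2"
    using assms by linarith
  then have "sqrt ((p - q)\<^sup>2 + 4 * c) \<le> \<bar>p - q\<bar> + 2 * d"
    using assms by (intro real_le_lsqrt) auto
  then show "(sqrt ((p - q)\<^sup>2 + 4 * c) + p + q) / 2 \<le> max p q + d"
    by (cases "p \<le> q") (auto simp: max_def)
qed

section \<open>The iteration\<close>

locale diagonal_gradient_method =
  fixes n :: nat and lam :: "nat \<Rightarrow> real" and b :: "real vec"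
    and x :: "nat \<Rightarrow> real vec" and \<alpha> :: "nat \<Rightarrow> real"
  assumes n_pos: "n \<ge> 1" and lam_1: "lam 1 = 1"
    and lam_mono: "\<And>i j. 1 \<le> i \<Longrightarrow> i \<le> j \<Longrightarrow> j \<le> n \<Longrightarrow> lam i \<le> lam j"
    and b_carrier: "b \<in> carrier_vec n" and x_0: "x 0 \<in> carrier_vec n"
    and method_steps: "gradient_method (diag_matrix n lam) b x \<alpha>"
begin

abbreviation "A \<equiv> diag_matrix n lam"
abbreviation "g \<equiv> grad A b x"
abbreviation "run \<equiv> running A b x"
abbreviation "ray k \<equiv> rayleigh n lam (g k)"

lemma lam_ge_1: "i < n \<Longrightarrow> 1 \<le> lam (Suc i)"
  using lam_mono[of 1 "Suc i"] lam_1 by simp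

lemma lam_le_lam_n: "i < n \<Longrightarrow> lam (Suc i) \<le> lam n"
  using lam_mono[of "Suc i" n] by simp

lemma lam_n_ge_1: "1 \<le> lam n"
  using lam_mono[of 1 n] lam_1 n_pos by simp

lemma run_mono: "run k \<Longrightarrow> j \<le> k \<Longrightarrow> run j"
  by (auto simp: running_def)

lemma step: "run k \<Longrightarrow> x (Suc k) = x k - \<alpha> k \<cdot>\<^sub>v g k"
  using method_steps by (simp add: gradient_method_def)

lemma x_carrier: "run k \<Longrightarrow> x k \<in> carrier_vec n"
proof (induction k)
  case 0
  show ?case by (rule x_0)
next
  case (Suc k)
  have "run k" using Suc.prems by (rule run_mono) simp
  with Suc.IH b_carrier show ?case
    by (simp add: step grad_def mult_mat_vec_carrier[OF diag_matrix_carrier])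
qed

lemma g_carrier: "run k \<Longrightarrow> g k \<in> carrier_vec n"
  using x_carrier b_carrier
  by (simp add: grad_def mult_mat_vec_carrier[OF diag_matrix_carrier])

lemma g_nonzero: "run k \<Longrightarrow> g k \<noteq> 0\<^sub>v n"
  using b_carrier by (auto simp: running_def)

lemma g_Suc:
  assumes "run (Suc k)" and i: "i < n"
  shows "g (Suc k) $ i = (1 - \<alpha> k * lam (Suc i)) * g k $ i"
proof -
  have k: "run k" using assms(1) by (rule run_mono) simp
  note car = x_carrier[OF k] x_carrier[OF assms(1)] g_carrier[OF k] b_carrier
  have x_i: "x (Suc k) $ i = x k $ i - \<alpha> k * g k $ i"
    using car i by (simp add: step[OF k])
  have g_i: "g j $ i = lam (Suc i) * x j $ i - b $ i" if "x j \<in> carrier_vec n" for j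
    using that i b_carrier by (simp add: grad_def diag_matrix_mult_vec)
  show ?thesis
    unfolding g_i[OF car(1)] g_i[OF car(2)] x_i by (simp add: algebra_simps)
qed

lemma inverse_sd_step: "inverse (sd_step A b x k) = ray k"
  by (simp add: sd_step_def rayleigh_def Let_def)

lemma ray_ge_1: "run k \<Longrightarrow> 1 \<le> ray k"
  using rayleigh_bounds(1)[of "g k" n 1 lam "lam n"] g_carrier g_nonzero lam_ge_1 lam_le_lam_n by simp

lemma ray_le_lam_n: "run k \<Longrightarrow> ray k \<le> lam n"
  using rayleigh_bounds(2)[of "g k" n 1 lam "lam n"] g_carrier g_nonzero lam_ge_1 lam_le_lam_n by simp

lemma sum_below_eq_G: "(\<Sum>i<\<mu>. (g k $ i)\<^sup>2) = G A b x k \<mu>"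
  unfolding G_def by (rule sum.reindex_bij_witness[of _ "\<lambda>i. i - 1" Suc]) auto

lemma ray_ge_of_dominant_component:
  assumes "run k" "\<mu> < n" "G A b x k \<mu> \<le> \<epsilon>" "2 * \<epsilon> \<le> (g k $ \<mu>)\<^sup>2"
  shows "2 / 3 * lam (Suc \<mu>) \<le> ray k"
proof (rule rayleigh_ge_of_dominant_component[OF g_carrier g_nonzero])
  show "0 \<le> lam (Suc i)" if "i < n" for i
    using lam_ge_1[OF that] by simp
qed (use assms sum_below_eq_G[where k = k and \<mu> = \<mu>] lam_mono in auto)

text \<open>
  With \<open>t = 1 / ray k\<close>, the factor \<open>1 - t * lam (Suc i)\<close> of each component has modulus at most
  \<open>lam n\<close>, because \<open>t\<close> is at most \<open>1\<close> and \<open>lam n\<close> at least \<open>1\<close>; the displacement is \<open>- t\<close>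
  times the old gradient, and \<open>t\<close> is at least \<open>1 / lam n\<close>.
\<close>
lemma gradient_displacement_ratio_le:
  assumes run: "run (Suc k)" and sd: "\<alpha> k = sd_step A b x k"
  defines "s \<equiv> x (Suc k) - x k"
  shows "(g (Suc k) \<bullet> g (Suc k)) / (s \<bullet> s) \<le> ((lam n)\<^sup>2)\<^sup>2"
proof -
  have k: "run k" using run by (rule run_mono) simp
  let ?L = "lam n"
  note gk = g_carrier[OF k]
  have t: "inverse (\<alpha> k) = ray k" using inverse_sd_step sd by simp
  have "1 \<le> inverse (\<alpha> k)" using t ray_ge_1[OF k] by simp
  then have t_pos: "0 < \<alpha> k" and t_le: "\<alpha> k \<le> 1" by (simp_all add: one_le_inverse_iff)
  have "1 = \<alpha> k * ray k" using t t_pos by (simp flip: t)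
  also have "\<dots> \<le> \<alpha> k * ?L" using ray_le_lam_n[OF k] t_pos by (simp add: mult_left_mono)
  finally have t_ge: "1 \<le> \<alpha> k * ?L" .
  have "g (Suc k) \<bullet> g (Suc k) \<le> ?L\<^sup>2 * (g k \<bullet> g k)"
    unfolding scalar_prod_self[OF g_carrier[OF run]] scalar_prod_self[OF gk] sum_distrib_left
  proof (rule sum_mono)
    fix i assume "i \<in> {..<n}"
    then have i: "i < n" by simp
    have "\<alpha> k * lam (Suc i) \<le> 1 * ?L"
      using t_pos t_le lam_ge_1[OF i] lam_le_lam_n[OF i] by (intro mult_mono) auto
    moreover have "0 \<le> \<alpha> k * lam (Suc i)"
      using t_pos lam_ge_1[OF i] by simp
    ultimately have "\<bar>1 - \<alpha> k * lam (Suc i)\<bar> \<le> ?L"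
      using lam_n_ge_1 by simp
    then have "(1 - \<alpha> k * lam (Suc i))\<^sup>2 \<le> ?L\<^sup>2"
      by (rule power2_le_iff_abs_le[THEN iffD2, rotated]) (use lam_n_ge_1 in simp)
    then show "(g (Suc k) $ i)\<^sup>2 \<le> ?L\<^sup>2 * (g k $ i)\<^sup>2"
      by (simp add: g_Suc[OF run i] power_mult_distrib mult_right_mono)
  qed
  moreover have "s \<bullet> s = (\<alpha> k)\<^sup>2 * (g k \<bullet> g k)"
  proof -
    have s: "s \<in> carrier_vec n"
      unfolding s_def using x_carrier[OF run] x_carrier[OF k] by simp
    have "s $ i = - (\<alpha> k * g k $ i)" if "i < n" for i
      unfolding s_def using that x_carrier[OF k] gk by (simp add: step[OF k])
    then show ?thesis
      by (simp add: scalar_prod_self[OF s] scalar_prod_self[OF gk] sum_distrib_left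
          power_mult_distrib)
  qed
  moreover have gg: "0 < g k \<bullet> g k"
    by (rule scalar_prod_self_pos[OF gk g_nonzero[OF k]])
  ultimately have "(g (Suc k) \<bullet> g (Suc k)) / (s \<bullet> s) \<le> (?L\<^sup>2 * (g k \<bullet> g k)) / ((\<alpha> k)\<^sup>2 * (g k \<bullet> g k))"
    by (metis divide_right_mono less_imp_le mult_nonneg_nonneg zero_le_power2)
  also have "\<dots> = ?L\<^sup>2 / (\<alpha> k)\<^sup>2"
    using gg by simp
  also have "\<dots> \<le> (?L\<^sup>2)\<^sup>2"
  proof -
    have "1 \<le> (\<alpha> k * ?L)\<^sup>2" using t_ge by (simp add: one_le_power)
    then have "?L\<^sup>2 * 1 \<le> ?L\<^sup>2 * (\<alpha> k * ?L)\<^sup>2" by (intro mult_left_mono) auto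
    then show ?thesis
      using t_pos by (simp add: pos_divide_le_eq power_mult_distrib ac_simps power2_eq_square)
  qed
  finally show ?thesis .
qed

lemma inverse_yuan_step_bounds:
  assumes run: "run (Suc k)" and sd: "\<alpha> k = sd_step A b x k"
  shows "ray (Suc k) \<le> inverse (yuan_step A b x (Suc k))"
    and "inverse (yuan_step A b x (Suc k)) \<le> lam n + (lam n)\<^sup>2"
proof -
  have k: "run k" using run by (rule run_mono) simp
  define c where "c = (g (Suc k) \<bullet> g (Suc k)) / ((x (Suc k) - x k) \<bullet> (x (Suc k) - x k))"
  have c: "0 \<le> c" "c \<le> ((lam n)\<^sup>2)\<^sup>2"
    unfolding c_def
    using gradient_displacement_ratio_le[OF assms] x_carrier[OF run] x_carrier[OF k]
    by (auto simp: scalar_prod_self[OF g_carrier[OF run]]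
        scalar_prod_self[of "x (Suc k) - x k" n] sum_nonneg)
  have eq: "inverse (yuan_step A b x (Suc k)) =
      (sqrt ((ray k - ray (Suc k))\<^sup>2 + 4 * c) + ray k + ray (Suc k)) / 2"
    by (simp add: yuan_step_def Let_def c_def inverse_sd_step[unfolded inverse_eq_divide])
  note bounds = yuan_formula_bounds[OF c, of "ray k" "ray (Suc k)", folded eq]
  show "ray (Suc k) \<le> inverse (yuan_step A b x (Suc k))"
    using bounds(1) by simp
  show "inverse (yuan_step A b x (Suc k)) \<le> lam n + (lam n)\<^sup>2"
    using bounds(2) ray_le_lam_n[OF k] ray_le_lam_n[OF run] by simp
qed

end

section \<open>The cyclic rule\<close>

locale cyclic_yuan_method = diagonal_gradient_method +
  fixes l m :: nat
  assumes cyclic_rule: "\<And>k. run k \<Longrightarrow> \<alpha> k = cy_step l m A b x \<alpha> k"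
begin

lemma sd_case:
  assumes "run k" "k mod (l + m + 2) < l + 2" "k mod (l + m + 2) \<noteq> 1"
  shows "\<alpha> k = sd_step A b x k"
  using cyclic_rule[OF assms(1)] assms(2,3) by (simp add: cy_step_def)

lemma fresh_step_bounds:
  assumes run: "run k" and fresh: "k mod (l + m + 2) < l + 2"
  shows "ray k \<le> inverse (\<alpha> k)" and "inverse (\<alpha> k) \<le> lam n + (lam n)\<^sup>2"
proof -
  have "ray k \<le> inverse (\<alpha> k) \<and> inverse (\<alpha> k) \<le> lam n + (lam n)\<^sup>2"
  proof (cases "k mod (l + m + 2) = 1")
    case False
    then show ?thesis
      using sd_case[OF run fresh] ray_le_lam_n[OF run] by (simp add: inverse_sd_step add_increasing2)
  next
    case True
    then obtain k' where k': "k = Suc k'" by (cases k) auto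
    have "k' mod (l + m + 2) = 0"
      using True unfolding k' by (simp add: mod_Suc split: if_splits)
    then have "\<alpha> k' = sd_step A b x k'"
      using run k' by (intro sd_case) (auto intro: run_mono)
    moreover have "\<alpha> k = yuan_step A b x k"
      using cyclic_rule[OF run] True by (simp add: cy_step_def)
    ultimately show ?thesis
      using inverse_yuan_step_bounds[of k'] run k' by simp
  qed
  then show "ray k \<le> inverse (\<alpha> k)" "inverse (\<alpha> k) \<le> lam n + (lam n)\<^sup>2" by auto
qed

text \<open>
  The delay \<open>j\<close> is \<open>0\<close> for a newly computed steplength and otherwise leads back to the residue
  \<open>l + 1\<close>.  The strict bound \<open>j < k\<close> for positive \<open>k\<close> matters: Property A makes no
  assumption on the gradient at index \<open>0\<close>.
\<close>
lemma step_eq_recent_fresh_step: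
  assumes run: "run k"
  obtains j where "j \<le> m" "j \<le> k - 1" "(k - j) mod (l + m + 2) < l + 2" "\<alpha> k = \<alpha> (k - j)"
proof (cases "k mod (l + m + 2) < l + 2")
  case True
  then show thesis using that[of 0] by simp
next
  case False
  have repeat: "\<alpha> k = \<alpha> (k - j)" if "l + 1 + j \<le> k mod (l + m + 2)" for j
    using that
  proof (induction j)
    case (Suc j)
    let ?P = "l + m + 2"
    have res: "(k - j) mod ?P = k mod ?P - j"
    proof -
      have "k - j = k div ?P * ?P + (k mod ?P - j)"
        using Suc.prems by (metis Nat.add_diff_assoc add_leE div_mult_mod_eq le_add2 le_trans plus_1_eq_Suc)
      moreover have "k mod ?P - j < ?P"
        by (rule le_less_trans[OF diff_le_self]) simp
      ultimately show ?thesis by (metis mod_mult_self3 mod_less)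
    qed
    have "\<alpha> (k - j) = \<alpha> (k - j - 1)"
    proof -
      have "\<not> k mod ?P - j < l + 2" "k mod ?P - j \<noteq> 1"
        using Suc.prems by linarith+
      then show ?thesis
        using cyclic_rule[OF run_mono[OF run diff_le_self[of k j]]]
        unfolding cy_step_def res by (simp only: if_False)
    qed
    then show ?case using Suc by simp
  qed simp
  define j where "j = k mod (l + m + 2) - (l + 1)"
  have le: "k mod (l + m + 2) \<le> k" by simp
  have lt: "k mod (l + m + 2) < l + m + 2" by simp
  have "k - j = k div (l + m + 2) * (l + m + 2) + (l + 1)"
    unfolding j_def using False div_mult_mod_eq[of k "l + m + 2"] by linarith
  then have "(k - j) mod (l + m + 2) = (l + 1) mod (l + m + 2)"
    by (metis mod_mult_self3)
  then have "(k - j) mod (l + m + 2) < l + 2"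
    by simp
  moreover have "j \<le> m" using lt unfolding j_def by linarith
  moreover have "j \<le> k - 1" using le unfolding j_def by linarith
  moreover have "\<alpha> k = \<alpha> (k - j)"
    using False by (intro repeat) (simp add: j_def)
  ultimately show thesis using that by blast
qed

lemma inverse_step_bounds:
  assumes run: "run k"
  shows "1 \<le> inverse (\<alpha> k)" and "inverse (\<alpha> k) \<le> lam n + (lam n)\<^sup>2"
proof -
  obtain j where j: "(k - j) mod (l + m + 2) < l + 2" "\<alpha> k = \<alpha> (k - j)"
    using step_eq_recent_fresh_step[OF run] by metis
  have "run (k - j)" using run by (rule run_mono) simp
  from fresh_step_bounds[OF this j(1)] ray_ge_1[OF this] j(2)
  show "1 \<le> inverse (\<alpha> k)" "inverse (\<alpha> k) \<le> lam n + (lam n)\<^sup>2" by auto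
qed

lemma inverse_step_ge_of_dominant_component:
  assumes run: "run k" and k: "k \<ge> 1" and \<mu>: "\<mu> < n"
    and dom: "\<forall>j\<in>{0..min k (m + 1) - 1}. G A b x (k - j) \<mu> \<le> \<epsilon> \<and> 2 * \<epsilon> \<le> (g (k - j) $ \<mu>)\<^sup>2"
  shows "2 / 3 * lam (Suc \<mu>) \<le> inverse (\<alpha> k)"
proof -
  obtain j where j: "j \<le> m" "j \<le> k - 1" "(k - j) mod (l + m + 2) < l + 2" "\<alpha> k = \<alpha> (k - j)"
    using step_eq_recent_fresh_step[OF run] by metis
  have r: "run (k - j)" using run by (rule run_mono) simp
  have "j \<in> {0..min k (m + 1) - 1}" using j k by auto
  with dom have "G A b x (k - j) \<mu> \<le> \<epsilon>" "2 * \<epsilon> \<le> (g (k - j) $ \<mu>)\<^sup>2" by blast+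
  then have "2 / 3 * lam (Suc \<mu>) \<le> ray (k - j)"
    by (rule ray_ge_of_dominant_component[OF r \<mu>])
  also have "\<dots> \<le> inverse (\<alpha> k)"
    using fresh_step_bounds(1)[OF r j(3)] j(4) by simp
  finally show ?thesis .
qed

lemma has_property_A: "property_A n lam b x \<alpha>"
  unfolding property_A_def Let_def
proof (intro exI conjI allI impI)
  show "0 < m + 1" by simp
  show "0 < lam n + (lam n)\<^sup>2" using lam_n_ge_1 by (simp add: add_pos_nonneg)
  show "(0::real) < 2" by simp
next
  fix k assume "run k"
  then show "lam 1 \<le> inverse (\<alpha> k)" "inverse (\<alpha> k) \<le> lam n + (lam n)\<^sup>2"
    using inverse_step_bounds lam_1 by auto
next
  fix k \<mu> and \<epsilon> :: real
  assume "run k" "k \<ge> 1" "\<mu> \<in> {1..n - 1}"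
    "\<forall>j\<in>{0..min k (m + 1) - 1}. G A b x (k - j) \<mu> \<le> \<epsilon> \<and> 2 * \<epsilon> \<le> (g (k - j) $ \<mu>)\<^sup>2"
  then show "2 / 3 * lam (\<mu> + 1) \<le> inverse (\<alpha> k)"
    using inverse_step_ge_of_dominant_component[of k \<mu> \<epsilon>] by auto
qed

end

theorem theorem4:
  fixes n l m :: nat
    and lam :: "nat \<Rightarrow> real"
    and b :: "real vec"
    and x :: "nat \<Rightarrow> real vec"
    and \<alpha> :: "nat \<Rightarrow> real"
  assumes "n \<ge> 1" and "l \<ge> 1" and "m \<ge> 1"
    and "lam 1 = 1"
    and "\<And>i j. 1 \<le> i \<Longrightarrow> i \<le> j \<Longrightarrow> j \<le> n \<Longrightarrow> lam i \<le> lam j"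
    and "b \<in> carrier_vec n"
    and "x 0 \<in> carrier_vec n"
    and "gradient_method (diag_matrix n lam) b x \<alpha>"
    and "\<And>k. running (diag_matrix n lam) b x k \<Longrightarrow>
           \<alpha> k = cy_step l m (diag_matrix n lam) b x \<alpha> k"
  shows "property_A n lam b x \<alpha>"
proof -
  interpret cyclic_yuan_method n lam b x \<alpha> l m
    by unfold_locales (fact assms)+
  show ?thesis by (rule has_property_A)
qed

end
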